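(* Let $n\ge2$, let $\Omega\subset\mathbb{R}^n$ be a domain, let $0<\delta\le1$, and let $f\colon\Omega\to\mathbb{R}^n$ be nonconstant and $\delta$-monotone. Then the image $f(\Gamma)$ of any $C^1$-curve $\Gamma\subset\Omega$ is locally rectifiable.
   Context: A map $f\colon\Omega\to\mathbb{R}^n$ is called $\delta$-monotone, $0<\delta\le 1$, if $$\langle f(a)-f(b),\,a-b\rangle\ \ge\ \delta\,|a-b|\,|f(a)-f(b)|\qquad\text{for all } a,b\in\Omega.$$ A $C^1$-curve is a curve with a $C^1$ parametrization $x\colon I\to\Omega$ ($I$ an interval) with $\dot x(t)\ne0$ for all $t\in I$. Its image $f(\Gamma)$ is locally rectifiable if every $t\in I$ has a neighbourhood in $I$ on which the parametric curve $f\circ x$ has finite length. *)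

theory Defs
  imports "HOL-Analysis.Analysis"
begin

definition delta_monotone_on :: "real \<Rightarrow> 'a::real_inner set \<Rightarrow> ('a \<Rightarrow> 'a) \<Rightarrow> bool" where
  "delta_monotone_on \<delta> \<Omega> f \<longleftrightarrow>
     (\<forall>a\<in>\<Omega>. \<forall>b\<in>\<Omega>. (f a - f b) \<bullet> (a - b) \<ge> \<delta> * norm (a - b) * norm (f a - f b))"

(* Derivatives are taken within I, hence one-sided at endpoints belonging to I, and the values
   of x outside I play no role.  (C1_differentiable_on would demand two-sided derivatives.) *)
definition C1_parametrization :: "real set \<Rightarrow> (real \<Rightarrow> 'a::real_normed_vector) \<Rightarrow> bool" where
  "C1_parametrization I x \<longleftrightarrow>
     is_interval I \<and>
     (\<exists>x'. (\<forall>t\<in>I. (x has_vector_derivative x' t) (at t within I)) \<and>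
           continuous_on I x' \<and> (\<forall>t\<in>I. x' t \<noteq> 0))"

(* Supremum of the lengths of inscribed polygons with nodes s 0 \<le> s 1 \<le> ... \<le> s N in J;
   J may be open, half-open or closed. *)
definition curve_length :: "real set \<Rightarrow> (real \<Rightarrow> 'a::metric_space) \<Rightarrow> ennreal" where
  "curve_length J g =
     Sup {ennreal (\<Sum>i<N. dist (g (s i)) (g (s (Suc i)))) | N s.
            mono_on {..N} s \<and> s ` {..N} \<subseteq> J}"

(* J is an interval that is a neighbourhood of t in the subspace I, not necessarily open in I. *)
definition locally_rectifiable_on :: "real set \<Rightarrow> (real \<Rightarrow> 'a::metric_space) \<Rightarrow> bool" where
  "locally_rectifiable_on I g \<longleftrightarrow>
     (\<forall>t\<in>I. \<exists>J U. is_interval J \<and> openin (top_of_set I) U \<and> t \<in> U \<and> U \<subseteq> J \<and> J \<subseteq> I \<and>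
        curve_length J g < \<infinity>)"

end

theory Submission
  imports Defs
begin

text \<open>Along a short arc of the curve all chords nearly point in one direction \<open>w\<close>, the velocity
  at a point of the arc. By \<open>\<delta>\<close>-monotonicity the increments of \<open>f\<close> along the arc then form an angle
  with \<open>w\<close> that is bounded away from \<open>\<pi>/2\<close>. So their norms are at most a constant times their
  components along \<open>w\<close>, and these telescope.\<close>

text \<open>Each edge of an inscribed polygon is at most \<open>1 / c\<close> times its component
  along \<open>w\<close>, and these components telescope, so one bound serves all polygons.\<close>

lemma curve_length_le_directional_increment:
  fixes g :: "real \<Rightarrow> 'a::real_inner"
  assumes "0 < c" "a \<le> b"
    and dir: "\<And>s t. \<lbrakk>s \<in> {a..b}; t \<in> {a..b}; s \<le> t\<rbrakk> \<Longrightarrow> c * dist (g s) (g t) \<le> (g t - g s) \<bullet> w"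
  shows "curve_length {a..b} g \<le> ennreal (((g b - g a) \<bullet> w) / c)"
  unfolding curve_length_def
proof (rule Sup_least, clarify)
  fix N :: nat and s :: "nat \<Rightarrow> real"
  assume mono: "mono_on {..N} s" and "s ` {..N} \<subseteq> {a..b}"
  then have s: "s i \<in> {a..b}" if "i \<le> N" for i
    using that by blast
  have nonneg: "0 \<le> (g t - g r) \<bullet> w" if "r \<in> {a..b}" "t \<in> {a..b}" "r \<le> t" for r t
    using dir[OF that] \<open>0 < c\<close> by (meson mult_nonneg_nonneg order.trans less_imp_le zero_le_dist)
  have "c * (\<Sum>i<N. dist (g (s i)) (g (s (Suc i)))) \<le> (\<Sum>i<N. (g (s (Suc i)) - g (s i)) \<bullet> w)"
    unfolding sum_distrib_left
    by (intro sum_mono dir s) (auto intro: mono_onD[OF mono])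
  also have "\<dots> = (g (s N) - g (s 0)) \<bullet> w"
    using sum_lessThan_telescope[of "\<lambda>i. g (s i)" N] by (simp flip: inner_sum_left)
  \<comment> \<open>The nodes need not start at \<open>a\<close> or end at \<open>b\<close>, but the
    missing increments have nonnegative component along \<open>w\<close>.\<close>
  also have "\<dots> \<le> (g b - g a) \<bullet> w"
    using nonneg[of "s N" b] nonneg[of a "s 0"] s[of N] s[of 0] \<open>a \<le> b\<close>
    by (auto simp: inner_diff_left)
  finally show "ennreal (\<Sum>i<N. dist (g (s i)) (g (s (Suc i)))) \<le> ennreal (((g b - g a) \<bullet> w) / c)"
    using \<open>0 < c\<close> by (intro ennreal_leI) (simp add: field_simps)
qed

text \<open>Supplies the interval and the relatively open set that local rectifiability asks for,
  also when \<open>t\<close> is an endpoint of \<open>I\<close>.\<close>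

lemma compact_interval_neighbourhood:
  fixes I :: "real set"
  assumes "is_interval I" "t \<in> I" "0 < r"
  obtains a b U where "a \<le> t" "t \<le> b" "{a..b} \<subseteq> I" "{a..b} \<subseteq> ball t r"
    "openin (top_of_set I) U" "t \<in> U" "U \<subseteq> {a..b}"
proof -
  \<comment> \<open>\<open>e1\<close> measures how far to the left of \<open>t\<close> the points of
    \<open>I\<close> are sure to stay in \<open>{a..}\<close>. If \<open>t\<close> is the least
    point of \<open>I\<close>, then \<open>a = t\<close> and any positive \<open>e1\<close>
    works.\<close>
  obtain a e1 where a: "a \<in> I" "a \<le> t" "t - r < a" "0 < e1" "\<forall>s\<in>I. t - e1 < s \<longrightarrow> a \<le> s"
  proof (cases "\<exists>s\<in>I. s < t")
    case True
    then obtain s where s: "s \<in> I" "s < t" by blast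
    define a where "a = max s (t - r / 2)"
    have "a \<in> I"
      using mem_is_interval_1_I[OF assms(1) s(1) assms(2), of a] s \<open>0 < r\<close> by (simp add: a_def)
    then show ?thesis
      using that[of a "t - a"] s \<open>0 < r\<close> by (auto simp: a_def)
  next
    case False
    then show ?thesis using that[of t 1] assms by force
  qed
  obtain b e2 where b: "b \<in> I" "t \<le> b" "b < t + r" "0 < e2" "\<forall>s\<in>I. s < t + e2 \<longrightarrow> s \<le> b"
  proof (cases "\<exists>s\<in>I. t < s")
    case True
    then obtain s where s: "s \<in> I" "t < s" by blast
    define b where "b = min s (t + r / 2)"
    have "b \<in> I"
      using mem_is_interval_1_I[OF assms(1,2) s(1), of b] s \<open>0 < r\<close> by (simp add: b_def)
    then show ?thesis
      using that[of b "b - t"] s \<open>0 < r\<close> by (auto simp: b_def)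
  next
    case False
    then show ?thesis using that[of t 1] assms by force
  qed
  show ?thesis
  proof
    show "{a..b} \<subseteq> I"
      using mem_is_interval_1_I[OF assms(1) a(1) b(1)] by auto
    show "openin (top_of_set I) (I \<inter> {t - e1<..<t + e2})"
      by (intro openin_open_Int) simp
  qed (use a b assms in \<open>auto simp: dist_real_def\<close>)
qed

text \<open>Replacing the chord \<open>q - p\<close> by \<open>h *\<^sub>R w\<close> changes the
  inner product with \<open>f q - f p\<close> by at most a quarter of
  \<open>\<delta> * h * norm w * norm (f q - f p)\<close>. Monotonicity on the chord provides at
  least three quarters of that quantity, so half remains.\<close>

lemma delta_monotone_increment_along:
  fixes f :: "'a::real_inner \<Rightarrow> 'a"
  assumes f: "delta_monotone_on \<delta> \<Omega> f" and "p \<in> \<Omega>" "q \<in> \<Omega>" "0 < \<delta>" "\<delta> \<le> 1" "0 < h"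
    and close: "norm (q - p - h *\<^sub>R w) \<le> \<delta> * norm w / 4 * h"
  shows "\<delta> * norm w / 2 * dist (f p) (f q) \<le> (f q - f p) \<bullet> w"
proof -
  define D d e where "D = f q - f p" and "d = q - p" and "e = d - h *\<^sub>R w"
  have "\<delta> * norm d * norm D \<le> D \<bullet> d"
    using f assms(2,3) unfolding delta_monotone_on_def D_def d_def by blast
  moreover have "D \<bullet> d = h * (D \<bullet> w) + D \<bullet> e"
    by (simp add: e_def inner_diff_right)
  moreover have "D \<bullet> e \<le> \<delta> * norm w / 4 * h * norm D"
    using norm_cauchy_schwarz[of D e] mult_left_mono[OF close, of "norm D"]
    by (simp add: e_def d_def mult_ac)
  \<comment> \<open>As \<delta> \<le> 1, the error \<open>e\<close> is no longer than a quarter of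
    \<open>h * norm w\<close>, so the chord keeps at least three quarters of that length.\<close>
  moreover have "\<delta> * (h * norm w * 3 / 4) * norm D \<le> \<delta> * norm d * norm D"
  proof (intro mult_right_mono mult_left_mono)
    have "h * norm w \<le> norm d + norm e"
      using norm_triangle_ineq4[of d e] \<open>0 < h\<close> by (simp add: e_def)
    moreover have "norm e \<le> \<delta> * (h * norm w) / 4"
      using close by (simp add: e_def d_def mult_ac)
    moreover have "\<delta> * (h * norm w) \<le> 1 * (h * norm w)"
      using \<open>\<delta> \<le> 1\<close> \<open>0 < h\<close> by (intro mult_right_mono) auto
    ultimately show "h * norm w * 3 / 4 \<le> norm d" by linarith
  qed (use \<open>0 < \<delta>\<close> in auto)
  ultimately have "h * (\<delta> * norm w / 2 * norm D) \<le> h * (D \<bullet> w)"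
    by (simp add: algebra_simps)
  then show ?thesis
    using \<open>0 < h\<close> by (simp add: D_def dist_norm norm_minus_commute)
qed

lemma locally_rectifiable_delta_monotone_image:
  fixes f :: "'a::real_inner \<Rightarrow> 'a"
  assumes f: "delta_monotone_on \<delta> \<Omega> f" and "0 < \<delta>" "\<delta> \<le> 1"
    and x: "C1_parametrization I x" "x ` I \<subseteq> \<Omega>"
  shows "locally_rectifiable_on I (f \<circ> x)"
  unfolding locally_rectifiable_on_def
proof
  fix t assume "t \<in> I"
  obtain x' where I: "is_interval I"
    and x': "\<And>t. t \<in> I \<Longrightarrow> (x has_vector_derivative x' t) (at t within I)"
    and cont: "continuous_on I x'" and nz: "x' t \<noteq> 0"
    using x(1) \<open>t \<in> I\<close> unfolding C1_parametrization_def by blast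
  define w where "w = x' t"
  \<comment> \<open>This is the relative error that \<open>delta_monotone_increment_along\<close>
    tolerates. It is positive because the velocity at \<open>t\<close> does not vanish.\<close>
  define \<eta> where "\<eta> = \<delta> * norm w / 4"
  have "w \<noteq> 0" "0 < \<eta>"
    using nz \<open>0 < \<delta>\<close> by (auto simp: w_def \<eta>_def)
  then obtain r where "0 < r" and r: "\<And>s. s \<in> I \<Longrightarrow> dist s t < r \<Longrightarrow> dist (x' s) w < \<eta>"
    using cont \<open>t \<in> I\<close> unfolding continuous_on_iff w_def by meson
  obtain a b U where ab: "a \<le> t" "t \<le> b" "{a..b} \<subseteq> I" "{a..b} \<subseteq> ball t r"
    and U: "openin (top_of_set I) U" "t \<in> U" "U \<subseteq> {a..b}"
    using compact_interval_neighbourhood[OF I \<open>t \<in> I\<close> \<open>0 < r\<close>] .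
  \<comment> \<open>Mean value inequality for \<open>x s - s *\<^sub>R w\<close>: its derivative
    \<open>x' s - w\<close> has norm at most \<eta> throughout the arc.\<close>
  have chord: "norm (x q - x p - (q - p) *\<^sub>R w) \<le> \<eta> * (q - p)"
    if "p \<in> {a..b}" "q \<in> {a..b}" "p \<le> q" for p q
  proof -
    have "((\<lambda>s. x s - s *\<^sub>R w) has_derivative (\<lambda>h. h *\<^sub>R (x' s - w))) (at s within {a..b})"
      if "s \<in> {a..b}" for s
    proof -
      have "(x has_vector_derivative x' s) (at s within {a..b})"
        using x'[of s] ab(3) that by (blast intro: has_vector_derivative_within_subset)
      then show ?thesis
        unfolding has_vector_derivative_def
        by (auto intro!: derivative_eq_intros simp: scaleR_diff_right)
    qed
    moreover have "onorm (\<lambda>h. h *\<^sub>R (x' s - w)) \<le> \<eta>" if "s \<in> {a..b}" for s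
    proof (rule onorm_le)
      have "s \<in> I" "dist s t < r"
        using ab that by (auto simp: subset_iff dist_commute)
      then have "norm (x' s - w) \<le> \<eta>"
        using r by (fastforce simp: dist_norm)
      then show "norm (h *\<^sub>R (x' s - w)) \<le> \<eta> * norm h" for h :: real
        using mult_left_mono[of "norm (x' s - w)" \<eta> "\<bar>h\<bar>"] by (simp add: mult.commute)
    qed
    ultimately have "norm ((x q - q *\<^sub>R w) - (x p - p *\<^sub>R w)) \<le> \<eta> * norm (q - p)"
      using that by (intro differentiable_bound[of "{a..b}"]) auto
    then show ?thesis
      using \<open>p \<le> q\<close> by (simp add: algebra_simps)
  qed
  have "curve_length {a..b} (f \<circ> x)
      \<le> ennreal ((((f \<circ> x) b - (f \<circ> x) a) \<bullet> w) / (\<delta> * norm w / 2))"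
  proof (rule curve_length_le_directional_increment)
    fix p q assume pq: "p \<in> {a..b}" "q \<in> {a..b}" "p \<le> q"
    show "\<delta> * norm w / 2 * dist ((f \<circ> x) p) ((f \<circ> x) q) \<le> ((f \<circ> x) q - (f \<circ> x) p) \<bullet> w"
    \<comment> \<open>The increment lemma needs a positive parameter step \<open>h = q - p\<close>;
      for \<open>p = q\<close> both sides are zero.\<close>
    proof (cases "p = q")
      case False
      have "x p \<in> \<Omega>" "x q \<in> \<Omega>"
        using pq ab(3) x(2) by blast+
      then show ?thesis
        using delta_monotone_increment_along[OF f, of "x p" "x q" "q - p" w]
          chord[OF pq] pq False assms(2,3) by (simp add: \<eta>_def)
    qed simp
  qed (use \<open>0 < \<delta>\<close> \<open>w \<noteq> 0\<close> ab in auto)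
  then have "curve_length {a..b} (f \<circ> x) < \<infinity>"
    using ennreal_less_top infinity_ennreal_def order_le_less_trans by metis
  then show "\<exists>J U. is_interval J \<and> openin (top_of_set I) U \<and> t \<in> U \<and> U \<subseteq> J \<and> J \<subseteq> I \<and>
      curve_length J (f \<circ> x) < \<infinity>"
    using U ab(3) by (intro exI[of _ "{a..b}"] exI[of _ U]) (simp add: is_interval_cc)
qed

theorem theorem1p10:
  fixes \<Omega> :: "(real ^ 'n) set" and f :: "real ^ 'n \<Rightarrow> real ^ 'n" and \<delta> :: real
    and I :: "real set" and x :: "real \<Rightarrow> real ^ 'n"
  assumes "CARD('n) \<ge> 2"
    and "open \<Omega>" and "connected \<Omega>"
    and "0 < \<delta>" and "\<delta> \<le> 1"
    and "\<not> f constant_on \<Omega>"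
    and "delta_monotone_on \<delta> \<Omega> f"
    and "C1_parametrization I x" and "x ` I \<subseteq> \<Omega>"
  shows "locally_rectifiable_on I (f \<circ> x)"
  using locally_rectifiable_delta_monotone_image[OF assms(7,4,5,8,9)] .

end
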